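(* Let $\varepsilon\in(0,1)$ and $p=p(n)=\omega(\log n/n)$, where $n\in 2\mathbb{N}$ is sufficiently large. Let $\{G_1,\ldots,G_{n/2}\}$ be a family of graphs on the same vertex set $V=[n]$, where the graphs $G_c$ are independent samples of $G(n,p)$. Then, whp, the following holds: for all spanning subgraphs $H_c\subseteq G_c$, $1\le c\le n/2$, with $\delta(H_c)\ge\left(\frac12+\varepsilon\right)np$ for every $c$, the family $\{H_1,\dots,H_{n/2}\}$ admits a rainbow perfect matching.
   Context: $[n]=\{1,\dots,n\}$. $G(n,p)$ is the binomial random graph on vertex set $[n]$: each unordered pair of vertices is an edge with probability $p$, independently. $\delta(H)$ denotes the minimum degree of $H$. $p=\omega(\log n/n)$ means $\frac{\log n/n}{p}\to0$ as $n\to\infty$. "Whp" (with high probability) means with probability tending to $1$ as $n\to\infty$ (here along even $n$). Rainbow: given a family $\{H_1,\ldots,H_m\}$ of not necessarily distinct graphs on the same vertex set $V$, a graph $F$ on $V$ is rainbow if there is an injection $\varphi:E(F)\to[m]$ such that $e\in E(H_{\varphi(e)})$ for every $e\in E(F)$. The family admits a rainbow perfect matching if some perfect matching $F$ on $V$ (a set of vertex-disjoint edges covering $V$) is rainbow with respect to the family. *)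

theory Defs
  imports "HOL-Probability.Probability" "HOL-Library.Landau_Symbols"
begin

text \<open>
  A simple graph on a given vertex set \<open>V\<close> is represented by its edge set, a set of two-element
  subsets of \<open>V\<close>.  A spanning subgraph of such a graph is thus a subset of its edge set.
\<close>

definition all_edges :: "'a set \<Rightarrow> 'a set set" where
  "all_edges V = {e. e \<subseteq> V \<and> card e = 2}"

definition degree :: "'a set set \<Rightarrow> 'a \<Rightarrow> nat" where
  "degree E v = card {e \<in> E. v \<in> e}"

text \<open>Meaningful only for finite nonempty \<open>V\<close>, like \<^const>\<open>Min\<close>.\<close>

definition min_degree :: "'a set \<Rightarrow> 'a set set \<Rightarrow> nat" where
  "min_degree V E = Min (degree E ` V)"

definition perfect_matching :: "'a set \<Rightarrow> 'a set set \<Rightarrow> bool" where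
  "perfect_matching V F \<longleftrightarrow> F \<subseteq> all_edges V \<and> pairwise disjnt F \<and> \<Union>F = V"

text \<open>A family \<open>H\<^sub>1, \<dots>, H\<^sub>m\<close> is a function of which only the values on \<open>{1..m}\<close> matter.\<close>

definition rainbow :: "nat \<Rightarrow> (nat \<Rightarrow> 'a set set) \<Rightarrow> 'a set set \<Rightarrow> bool" where
  "rainbow m H F \<longleftrightarrow> (\<exists>\<phi>. inj_on \<phi> F \<and> \<phi> ` F \<subseteq> {1..m} \<and> (\<forall>e\<in>F. e \<in> H (\<phi> e)))"

definition admits_rainbow_perfect_matching ::
    "'a set \<Rightarrow> nat \<Rightarrow> (nat \<Rightarrow> 'a set set) \<Rightarrow> bool" where
  "admits_rainbow_perfect_matching V m H \<longleftrightarrow> (\<exists>F. perfect_matching V F \<and> rainbow m H F)"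

definition binomial_random_graph :: "nat \<Rightarrow> real \<Rightarrow> nat set set pmf" where
  "binomial_random_graph n p =
     map_pmf (\<lambda>present. {e \<in> all_edges {1..n}. present e})
       (Pi_pmf (all_edges {1..n}) False (\<lambda>_. bernoulli_pmf p))"

text \<open>The joint law of \<open>m\<close> independent samples of \<open>G(n,p)\<close>, indexed by \<open>{1..m}\<close>.\<close>

definition random_graph_family :: "nat \<Rightarrow> nat \<Rightarrow> real \<Rightarrow> (nat \<Rightarrow> nat set set) pmf" where
  "random_graph_family m n p = Pi_pmf {1..m} {} (\<lambda>_. binomial_random_graph n p)"

definition even_at_top :: "nat filter" where
  "even_at_top = inf at_top (principal {n. even n})"

text \<open>
  Library \<open>\<omega>\<close> amounts to the quotient condition \<open>(log n / n) / p \<rightarrow> 0\<close>, where \<open>p\<close> has to be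
  eventually nonzero because division by zero yields zero in HOL.
\<close>

lemma smallomega_log_over_n_iff:
  "p \<in> \<omega>[even_at_top](\<lambda>n. ln (real n) / real n) \<longleftrightarrow>
     eventually (\<lambda>n. p n \<noteq> 0) even_at_top \<and>
     ((\<lambda>n. (ln (real n) / real n) / p n) \<longlongrightarrow> 0) even_at_top"
  (is "?L \<longleftrightarrow> ?R")
proof
  assume L: ?L
  have "eventually (\<lambda>n. norm (p n) \<ge> 1 * norm (ln (real n) / real n)) even_at_top"
    using L by (rule landau_omega.smallD) simp
  moreover have "eventually (\<lambda>n. n \<ge> 2) even_at_top"
    unfolding even_at_top_def
    by (rule filter_leD[OF inf_le1 eventually_ge_at_top])
  ultimately have "eventually (\<lambda>n. p n \<noteq> 0) even_at_top"
  proof eventually_elim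
    case (elim n)
    then have "ln (real n) / real n > 0"
      by simp
    with elim(1) show ?case
      unfolding real_norm_def by linarith
  qed
  moreover have "((\<lambda>n. (ln (real n) / real n) / p n) \<longlongrightarrow> 0) even_at_top"
    using L by (intro smalloD_tendsto) (simp add: smallomega_iff_smallo)
  ultimately show ?R ..
next
  assume ?R
  then show ?L
    unfolding smallomega_iff_smallo by (intro smalloI_tendsto) auto
qed

end

theory Submission
  imports Defs "HOL-Combinatorics.Permutations"
begin

text \<open>
  The rainbow problem is reduced to perfect matchings in an ordinary bipartite graph by a random
  assignment of vertices.  Let \<open>n = 2 * m\<close>.  A permutation \<open>\<sigma>\<close> of the vertices puts \<open>\<sigma> i\<close> at position
  \<open>i\<close>; the first \<open>m\<close> positions form the left side, the others the right side, and the left position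
  \<open>i\<close> carries the colour \<open>i\<close>.  Positions \<open>i \<le> m < j\<close> are joined if \<open>{\<sigma> i, \<sigma> j}\<close> is an edge of the
  graph of colour \<open>i\<close>.  A perfect matching of this bipartite graph is a rainbow perfect matching.

  For a fixed \<open>\<sigma>\<close>, the graphs \<open>G c\<close> induce a binomial random bipartite graph.  Chernoff's inequality
  and a union bound show that it is unlikely to have a dense spot, that is, sets \<open>S\<close> and \<open>T\<close> on the
  two sides, of at most \<open>m\<close> elements in total, which span about as many edges as a violation of
  Hall's condition would force on a subgraph of minimum degree \<open>(1/2 + \<epsilon>/2) * m * p\<close>
  (\<open>prob_dense_spot\<close>, \<open>perfect_matching_if_locally_sparse\<close>).  Therefore, by Markov's inequality, with
  high probability over \<open>G\<close> fewer than half of all \<open>\<sigma>\<close> have a dense spot (\<open>prob_many_dense_spots\<close>).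

  The adversary's graphs \<open>H c\<close> depend on \<open>G\<close>, but not on \<open>\<sigma>\<close>.  With \<open>H\<close> fixed, every degree in the
  bipartite graph induced by \<open>H\<close> is governed by a sum of the form \<open>\<Sum>i. a i (\<sigma> i)\<close> with entries in
  \<open>{0, 1}\<close> and mean at least \<open>(1/2 + \<epsilon>) * m * p\<close>.  Such sums have exponentially small lower tails in
  terms of their mean (\<open>permutation_lower_tail\<close>, proved by exchangeable pairs), and since \<open>n * p\<close> is
  large compared with \<open>ln n\<close>, at most half of all \<open>\<sigma>\<close> spoil one of the at most \<open>n\<^sup>2\<close> degrees.  Hence
  some \<open>\<sigma>\<close> has no dense spot and large degrees, and Hall's theorem applies.
\<close>

section \<open>Perfect matchings in bipartite graphs\<close>

text \<open>
  Hall's marriage theorem, by the argument of Halmos and Vaughan.  If some proper nonempty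
  subfamily \<open>J\<close> is tight, it is matched inside its own neighbourhood \<open>U\<close>, and Hall's condition
  survives on the rest after \<open>U\<close> is deleted.  Otherwise every proper nonempty subfamily has a
  neighbour to spare, so that any single pair may be matched and removed.
\<close>

lemma hall_marriage:
  fixes N :: "'a \<Rightarrow> 'b set"
  assumes "finite I" and "\<And>i. i \<in> I \<Longrightarrow> finite (N i)"
    and "\<And>J. J \<subseteq> I \<Longrightarrow> card J \<le> card (\<Union>(N ` J))"
  shows "\<exists>f. inj_on f I \<and> (\<forall>i\<in>I. f i \<in> N i)"
  using assms
proof (induction "card I" arbitrary: I N rule: less_induct)
  case less
  note finN = \<open>\<And>i. i \<in> I \<Longrightarrow> finite (N i)\<close> and hall = \<open>\<And>J. J \<subseteq> I \<Longrightarrow> card J \<le> card (\<Union>(N ` J))\<close>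
  consider "I = {}" 
    | J where "J \<subset> I" "J \<noteq> {}" "card (\<Union>(N ` J)) = card J"
    | "I \<noteq> {}" "\<And>J. J \<subset> I \<Longrightarrow> J \<noteq> {} \<Longrightarrow> card J < card (\<Union>(N ` J))"
    using hall by (metis order_le_less psubset_imp_subset)
  then show ?case
  proof cases
    case 1
    then show ?thesis by simp
  next
    case (2 J)
    define U where "U = \<Union>(N ` J)"
    have finJ: "finite J" using 2(1) less.prems(1) by (meson finite_subset psubset_imp_subset)
    have "\<exists>f. inj_on f J \<and> (\<forall>i\<in>J. f i \<in> N i)"
    proof (rule less.hyps)
      show "card J < card I" using 2(1) less.prems(1) by (rule psubset_card_mono[rotated])
      show "card K \<le> card (\<Union>(N ` K))" if "K \<subseteq> J" for K
        using hall[of K] that 2(1) by blast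
    qed (use finJ finN 2(1) in blast)+
    then obtain f where f: "inj_on f J" "\<And>i. i \<in> J \<Longrightarrow> f i \<in> N i" by blast
    have "\<exists>g. inj_on g (I - J) \<and> (\<forall>i\<in>I - J. g i \<in> N i - U)"
    proof (rule less.hyps)
      show "card (I - J) < card I"
        using 2(1,2) less.prems(1) by (intro psubset_card_mono) auto
      show "card K \<le> card (\<Union>i\<in>K. N i - U)" if K: "K \<subseteq> I - J" for K
      proof -
        have finK: "finite K" using K less.prems(1) by (meson finite_Diff finite_subset)
        have "card K + card J = card (K \<union> J)"
          using K finJ finK by (subst card_Un_disjoint) auto
        also have "\<dots> \<le> card (\<Union>(N ` (K \<union> J)))"
          using K 2(1) by (intro hall) auto
        also have "\<Union>(N ` (K \<union> J)) = (\<Union>i\<in>K. N i - U) \<union> U"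
          by (auto simp: U_def)
        also have "card \<dots> \<le> card (\<Union>i\<in>K. N i - U) + card U"
          by (rule card_Un_le)
        finally show ?thesis using 2(3) by (simp add: U_def)
      qed
    qed (use less.prems in auto)
    then obtain g where g: "inj_on g (I - J)" "\<And>i. i \<in> I - J \<Longrightarrow> g i \<in> N i - U" by blast
    have "f ` J \<inter> g ` (I - J) = {}"
      proof (intro equals0I)
      fix z assume "z \<in> f ` J \<inter> g ` (I - J)"
      then obtain i k where "i \<in> J" "z = f i" "k \<in> I - J" "z = g k" by auto
      then show False using f(2)[of i] g(2)[of k] by (auto simp: U_def)
    qed
    then have "inj_on (\<lambda>i. if i \<in> J then f i else g i) (J \<union> (I - J))"
      using f(1) g(1) by (rule inj_on_disjoint_Un[rotated 2])
    moreover have "J \<union> (I - J) = I" using 2(1) by blast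
    ultimately have "inj_on (\<lambda>i. if i \<in> J then f i else g i) I" by simp
    then show ?thesis using f g by (intro exI[of _ "\<lambda>i. if i \<in> J then f i else g i"]) auto
  next
    case 3
    then obtain i where i: "i \<in> I" by blast
    then have "card {i} \<le> card (\<Union>(N ` {i}))" by (intro hall) auto
    then obtain y where y: "y \<in> N i" by fastforce
    have "\<exists>g. inj_on g (I - {i}) \<and> (\<forall>k\<in>I - {i}. g k \<in> N k - {y})"
    proof (rule less.hyps)
      show "card (I - {i}) < card I" using i less.prems(1) by (rule card_Diff1_less[rotated])
      show "card K \<le> card (\<Union>k\<in>K. N k - {y})" if K: "K \<subseteq> I - {i}" for K
      proof (cases "K = {}")
        case False
        then have "card K < card (\<Union>(N ` K))" using K i by (intro 3) auto
        moreover have "\<Union>(N ` K) - {y} = (\<Union>k\<in>K. N k - {y})" by auto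
        moreover have "card (\<Union>(N ` K)) - card {y} \<le> card (\<Union>(N ` K) - {y})"
          by (rule diff_card_le_card_Diff) simp
        ultimately show ?thesis by simp
      qed simp
    qed (use less.prems in auto)
    then obtain g where g: "inj_on g (I - {i})" "\<And>k. k \<in> I - {i} \<Longrightarrow> g k \<in> N k - {y}" by blast
    have "inj_on (g(i := y)) (I - {i})"
      using g(1) by (rule inj_on_cong[THEN iffD1, rotated]) auto
    moreover have "y \<notin> (g(i := y)) ` (I - {i})" using g(2) by auto
    ultimately have "inj_on (g(i := y)) (insert i (I - {i}))"
      unfolding inj_on_insert by simp
    then have "inj_on (g(i := y)) I" using i by (simp add: insert_absorb)
    then show ?thesis using g y by (intro exI[of _ "g(i := y)"]) auto
  qed
qed

text \<open>
  Minimum degree \<open>D\<close> forces many edges between a set and its neighbourhood, so a set that violates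
  Hall's condition would be a dense pair \<open>(S, T)\<close>.  Up to passing to the complements, the dense
  pair has at most \<open>m\<close> vertices; this bound is what later makes dense pairs improbable in a random
  graph.
\<close>

lemma perfect_matching_if_locally_sparse:
  fixes E :: "'a \<Rightarrow> 'b \<Rightarrow> bool" and D :: real
  assumes "finite L" "finite R" "card L = m" "card R = m"
    and degL: "\<And>x. x \<in> L \<Longrightarrow> D \<le> card {y \<in> R. E x y}"
    and degR: "\<And>y. y \<in> R \<Longrightarrow> D \<le> card {x \<in> L. E x y}"
    and sparse: "\<And>S T. \<lbrakk>S \<subseteq> L; T \<subseteq> R; S \<noteq> {} \<or> T \<noteq> {}; card S + card T \<le> m\<rbrakk> \<Longrightarrow>
      card {(x, y) \<in> S \<times> T. E x y} < (card S + card T) / 2 * D"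
  shows "\<exists>f. bij_betw f L R \<and> (\<forall>x\<in>L. E x (f x))"
proof -
  have "card S \<le> card (\<Union>x\<in>S. {y \<in> R. E x y})" if S: "S \<subseteq> L" for S
  proof (rule ccontr)
    define T where "T = (\<Union>x\<in>S. {y \<in> R. E x y})"
    assume "\<not> card S \<le> card (\<Union>x\<in>S. {y \<in> R. E x y})"
    then have less: "card T < card S" by (simp add: T_def)
    have TR: "T \<subseteq> R" by (auto simp: T_def)
    have finS: "finite S" and finT: "finite T" using S TR assms by (auto intro: finite_subset)
    have D: "0 \<le> D"
    proof -
      obtain x where "x \<in> S" using less by fastforce
      then have "card {(u, v) \<in> {x} \<times> {}. E u v} < (card {x} + card ({}::'b set)) / 2 * D"
        using S less assms(1,3) by (intro sparse) (auto simp: Suc_le_eq card_gt_0_iff)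
      then show ?thesis by simp
    qed
    show False
    \<comment> \<open>All edges at \<open>S\<close> end in \<open>T\<close>, and all edges at \<open>R - T\<close> end in \<open>L - S\<close>: one of the two pairs
      is small enough, and in either pair the side with forced edges is the larger one.\<close>
    proof (cases "card S + card T \<le> m")
      case True
      have "(card S + card T) / 2 * D \<le> card S * D"
        using less D by (intro mult_right_mono) auto
      also have "\<dots> \<le> (\<Sum>x\<in>S. real (card {y \<in> R. E x y}))"
        using S degL by (intro sum_bounded_below) auto
      also have "\<dots> = card (SIGMA x:S. {y \<in> R. E x y})"
        using finS assms(2) by simp
      also have "(SIGMA x:S. {y \<in> R. E x y}) = {(x, y) \<in> S \<times> T. E x y}"
        by (auto simp: T_def)
      finally have "(card S + card T) / 2 * D \<le> card {(x, y) \<in> S \<times> T. E x y}" .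
      moreover have "S \<noteq> {}" using less by auto
      ultimately show False using sparse[OF S TR _ True] by linarith
    next
      case False
      let ?S = "L - S" and ?T = "R - T"
      have cS: "card ?S = m - card S" and cT: "card ?T = m - card T"
        using S TR assms finS finT by (auto simp: card_Diff_subset)
      have le: "card S \<le> m" using S assms by (metis card_mono)
      have sum_le: "card ?S + card ?T \<le> m" using False cS cT le less by linarith
      have lt: "card ?S < card ?T" using cS cT le less by linarith
      have "(card ?S + card ?T) / 2 * D \<le> card ?T * D"
        using lt D by (intro mult_right_mono) auto
      also have "\<dots> \<le> (\<Sum>y\<in>?T. real (card {x \<in> L. E x y}))"
        using degR by (intro sum_bounded_below) auto
      also have "\<dots> = card (SIGMA y:?T. {x \<in> L. E x y})"
        using assms(1,2) by simp
      also have "\<dots> = card {(x, y) \<in> ?S \<times> ?T. E x y}"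
        by (rule arg_cong[of _ _ real], rule bij_betw_same_card[of prod.swap]) (auto simp: bij_betw_def inj_on_def image_iff T_def)
      finally have "(card ?S + card ?T) / 2 * D \<le> card {(x, y) \<in> ?S \<times> ?T. E x y}" .
      moreover have "?T \<noteq> {}" using lt by (metis card.empty not_less_zero)
      ultimately show False using sparse[OF _ _ _ sum_le] by (meson Diff_subset not_less)
    qed
  qed
  then have "\<exists>f. inj_on f L \<and> (\<forall>x\<in>L. f x \<in> {y \<in> R. E x y})"
    using assms(1,2) by (intro hall_marriage) auto
  then obtain f where f: "inj_on f L" "\<And>x. x \<in> L \<Longrightarrow> f x \<in> R \<and> E x (f x)" by blast
  moreover have "f ` L = R"
    using f assms(1-4) by (intro card_subset_eq) (auto simp: card_image)
  ultimately show ?thesis by (auto simp: bij_betw_def)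
qed

section \<open>Lower tail of a sum along a random permutation\<close>

text \<open>
  A random transposition perturbs a random permutation \<open>\<sigma>\<close> into another one, and by this formula it
  changes the sum of \<open>a i (\<sigma> i)\<close> in only two places.
\<close>

lemma sum_compose_transpose:
  fixes a :: "'a \<Rightarrow> 'b \<Rightarrow> real"
  assumes "finite S" "I \<in> S" "J \<in> S"
  shows "(\<Sum>i\<in>S. a i ((\<sigma> \<circ> Transposition.transpose I J) i)) =
    (\<Sum>i\<in>S. a i (\<sigma> i)) - (a I (\<sigma> I) + a J (\<sigma> J)) + (a I (\<sigma> J) + a J (\<sigma> I))"
proof (cases "I = J")
  case False
  have split: "sum g S = sum g (S - {I, J}) + (g I + g J)" for g :: "'a \<Rightarrow> real"
    using assms False by (subst sum.subset_diff[of "{I, J}"]) auto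
  have "(\<Sum>i\<in>S - {I, J}. a i ((\<sigma> \<circ> Transposition.transpose I J) i)) = (\<Sum>i\<in>S - {I, J}. a i (\<sigma> i))"
    by (intro sum.cong) (auto simp: transpose_def)
  then show ?thesis by (simp add: split)
qed simp

text \<open>
  In absolute value, the slope of a secant of \<open>exp (- l * x)\<close> is at most \<open>l\<close> times the larger of the two values at its
  ends, hence at most \<open>l\<close> times their sum; the symmetric form is convenient for exchangeable pairs.
\<close>

lemma exp_secant_bound:
  fixes x y l :: real
  assumes "0 \<le> l"
  shows "- l * (x - y)\<^sup>2 * (exp (- l * x) + exp (- l * y)) \<le> (x - y) * (exp (- l * x) - exp (- l * y))"
proof -
  have *: "(u - v) * (exp (- l * v) - exp (- l * u)) \<le> l * (u - v)\<^sup>2 * (exp (- l * v) + exp (- l * u))"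
    if "v \<le> u" for u v :: real
  proof -
    have "exp (- l * v) - exp (- l * u) = exp (- l * v) * (1 - exp (- (l * (u - v))))"
      by (simp add: algebra_simps flip: exp_add)
    also have "\<dots> \<le> exp (- l * v) * (l * (u - v))"
      using exp_ge_add_one_self[of "- (l * (u - v))"] by (intro mult_left_mono) auto
    also have "\<dots> \<le> (exp (- l * v) + exp (- l * u)) * (l * (u - v))"
      using that assms by (intro mult_right_mono) auto
    finally have "(u - v) * (exp (- l * v) - exp (- l * u)) \<le>
      (u - v) * ((exp (- l * v) + exp (- l * u)) * (l * (u - v)))"
      using that by (intro mult_left_mono) auto
    then show ?thesis by (simp add: power2_eq_square mult_ac)
  qed
  show ?thesis
    using *[of x y] *[of y x] by (cases "x \<le> y") (auto simp: power2_commute algebra_simps)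
qed

text \<open>
  Chatterjee's method of exchangeable pairs, applied to \<open>\<sigma>\<close> and \<open>\<sigma>' = \<sigma> \<circ> transpose I J\<close> for uniform
  \<open>I, J\<close>.  Let \<open>n\<close> be the size of \<open>S\<close>.  The mean of \<open>X \<sigma> - X \<sigma>'\<close> over \<open>I, J\<close> is \<open>2 / n\<close> times
  \<open>X \<sigma> - \<mu>\<close>, and the mean of its square is at most \<open>4 / n\<close> times \<open>X \<sigma> + \<mu>\<close>, since the entries of \<open>a\<close>
  lie between 0 and 1.  Exchanging \<open>\<sigma>\<close> and \<open>\<sigma>'\<close> turns the drift into a product of increments of \<open>X\<close>
  and of \<open>exp (- l * X)\<close>, which the secant bound compares with the square.  That the error involves
  \<open>\<mu>\<close> and not \<open>n\<close> is essential: it gives Poisson-type tails, as needed for sparse graphs.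
\<close>

lemma exchangeable_pair_inequality:
  fixes a :: "'a \<Rightarrow> 'a \<Rightarrow> real"
  assumes "finite S" "S \<noteq> {}" "0 \<le> l"
    and a: "\<And>i j. i \<in> S \<Longrightarrow> j \<in> S \<Longrightarrow> 0 \<le> a i j \<and> a i j \<le> 1"
  defines "P \<equiv> {\<sigma>. \<sigma> permutes S}"
    and "X \<equiv> \<lambda>\<sigma>. \<Sum>i\<in>S. a i (\<sigma> i)"
    and "\<mu> \<equiv> (\<Sum>i\<in>S. \<Sum>j\<in>S. a i j) / card S"
  shows "- 2 * l * (\<Sum>\<sigma>\<in>P. (X \<sigma> + \<mu>) * exp (- l * X \<sigma>)) \<le> (\<Sum>\<sigma>\<in>P. (X \<sigma> - \<mu>) * exp (- l * X \<sigma>))"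
proof -
  let ?n = "real (card S)" and ?w = "\<lambda>\<sigma>. exp (- l * X \<sigma>)"
  let ?\<tau> = "\<lambda>\<sigma> I J. \<sigma> \<circ> Transposition.transpose I J"
  have n: "?n > 0" using assms by (simp add: card_gt_0_iff)
  have diff: "X \<sigma> - X (?\<tau> \<sigma> I J) = a I (\<sigma> I) + a J (\<sigma> J) - a I (\<sigma> J) - a J (\<sigma> I)"
    if "I \<in> S" "J \<in> S" for \<sigma> I J
    using sum_compose_transpose[OF assms(1) that, of a \<sigma>] by (simp add: X_def)
  have row: "(\<Sum>J\<in>S. g (\<sigma> J)) = (\<Sum>j\<in>S. g j)" if "\<sigma> \<in> P" for \<sigma> and g :: "'a \<Rightarrow> real"
    using that sum.permute[of \<sigma> S g] by (simp add: P_def o_def)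
  have drift: "(\<Sum>I\<in>S. \<Sum>J\<in>S. X \<sigma> - X (?\<tau> \<sigma> I J)) = 2 * ?n * (X \<sigma> - \<mu>)"
    and spread: "(\<Sum>I\<in>S. \<Sum>J\<in>S. (X \<sigma> - X (?\<tau> \<sigma> I J))\<^sup>2) \<le> 4 * ?n * (X \<sigma> + \<mu>)"
    if \<sigma>: "\<sigma> \<in> P" for \<sigma>
  proof -
    have 1: "(\<Sum>I\<in>S. \<Sum>J\<in>S. a I (\<sigma> I)) = ?n * X \<sigma>"
      by (simp add: X_def sum_distrib_left)
    have 2: "(\<Sum>I\<in>S. \<Sum>J\<in>S. a J (\<sigma> J)) = ?n * X \<sigma>"
      by (simp add: X_def)
    have 3: "(\<Sum>I\<in>S. \<Sum>J\<in>S. a I (\<sigma> J)) = ?n * \<mu>"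
      using n by (simp add: row[OF \<sigma>] \<mu>_def)
    have 4: "(\<Sum>I\<in>S. \<Sum>J\<in>S. a J (\<sigma> I)) = ?n * \<mu>"
      using 3 by (subst sum.swap)
    have "(\<Sum>I\<in>S. \<Sum>J\<in>S. X \<sigma> - X (?\<tau> \<sigma> I J)) =
      (\<Sum>I\<in>S. \<Sum>J\<in>S. a I (\<sigma> I) + a J (\<sigma> J) - a I (\<sigma> J) - a J (\<sigma> I))"
      by (intro sum.cong refl diff)
    also have "\<dots> = 2 * ?n * (X \<sigma> - \<mu>)"
      using 1 2 3 4 by (simp add: sum.distrib sum_subtractf algebra_simps)
    finally show "(\<Sum>I\<in>S. \<Sum>J\<in>S. X \<sigma> - X (?\<tau> \<sigma> I J)) = 2 * ?n * (X \<sigma> - \<mu>)" .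
    have "(X \<sigma> - X (?\<tau> \<sigma> I J))\<^sup>2 \<le> 2 * (a I (\<sigma> I) + a J (\<sigma> J) + a I (\<sigma> J) + a J (\<sigma> I))"
      if IJ: "I \<in> S" "J \<in> S" for I J
    proof -
      have "\<sigma> I \<in> S" "\<sigma> J \<in> S" using \<sigma> IJ by (auto simp: P_def permutes_in_image)
      note b = a[OF IJ(1) this(1)] a[OF IJ(2) this(2)] a[OF IJ(1) this(2)] a[OF IJ(2) this(1)]
      let ?d = "X \<sigma> - X (?\<tau> \<sigma> I J)"
      have "?d\<^sup>2 = \<bar>?d\<bar> * \<bar>?d\<bar>" by (simp add: power2_eq_square)
      also have "\<dots> \<le> 2 * (a I (\<sigma> I) + a J (\<sigma> J) + a I (\<sigma> J) + a J (\<sigma> I))"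
        unfolding diff[OF IJ] using b by (intro mult_mono) auto
      finally show ?thesis .
    qed
    then have "(\<Sum>I\<in>S. \<Sum>J\<in>S. (X \<sigma> - X (?\<tau> \<sigma> I J))\<^sup>2) \<le>
      (\<Sum>I\<in>S. \<Sum>J\<in>S. 2 * (a I (\<sigma> I) + a J (\<sigma> J) + a I (\<sigma> J) + a J (\<sigma> I)))"
      by (intro sum_mono) auto
    also have "\<dots> = 4 * ?n * (X \<sigma> + \<mu>)"
      using 1 2 3 4 by (simp add: sum.distrib algebra_simps flip: sum_distrib_left)
    finally show "(\<Sum>I\<in>S. \<Sum>J\<in>S. (X \<sigma> - X (?\<tau> \<sigma> I J))\<^sup>2) \<le> 4 * ?n * (X \<sigma> + \<mu>)" .
  qed
  have swap: "(\<Sum>\<sigma>\<in>P. g (?\<tau> \<sigma> I J)) = (\<Sum>\<sigma>\<in>P. g \<sigma>)" if "I \<in> S" "J \<in> S"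
    for I J and g :: "('a \<Rightarrow> 'a) \<Rightarrow> real"
    using that
    by (intro sum.reindex_bij_witness[of _ "\<lambda>\<sigma>. ?\<tau> \<sigma> I J" "\<lambda>\<sigma>. ?\<tau> \<sigma> I J"])
      (auto simp: P_def o_assoc[symmetric] intro!: permutes_compose permutes_swap_id)
  have invol: "?\<tau> (?\<tau> \<sigma> I J) I J = \<sigma>" for \<sigma> :: "'a \<Rightarrow> 'a" and I J
    by (simp add: o_assoc[symmetric])
  have pair: "- l * (\<Sum>\<sigma>\<in>P. (X \<sigma> - X (?\<tau> \<sigma> I J))\<^sup>2 * ?w \<sigma>) \<le> (\<Sum>\<sigma>\<in>P. (X \<sigma> - X (?\<tau> \<sigma> I J)) * ?w \<sigma>)"
    if IJ: "I \<in> S" "J \<in> S" for I J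
  proof -
    let ?d = "\<lambda>\<sigma>. X \<sigma> - X (?\<tau> \<sigma> I J)"
    have A: "(\<Sum>\<sigma>\<in>P. ?d \<sigma> * ?w (?\<tau> \<sigma> I J)) = - (\<Sum>\<sigma>\<in>P. ?d \<sigma> * ?w \<sigma>)"
    proof -
      have "(\<Sum>\<sigma>\<in>P. ?d \<sigma> * ?w (?\<tau> \<sigma> I J)) = (\<Sum>\<sigma>\<in>P. - ?d (?\<tau> \<sigma> I J) * ?w (?\<tau> \<sigma> I J))"
        by (simp add: invol)
      also have "\<dots> = (\<Sum>\<sigma>\<in>P. - ?d \<sigma> * ?w \<sigma>)"
        by (rule swap[OF IJ, of "\<lambda>\<sigma>. - ?d \<sigma> * ?w \<sigma>"])
      finally show ?thesis by (simp only: mult_minus_left sum_negf)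
    qed
    have B: "(\<Sum>\<sigma>\<in>P. (?d \<sigma>)\<^sup>2 * ?w (?\<tau> \<sigma> I J)) = (\<Sum>\<sigma>\<in>P. (?d \<sigma>)\<^sup>2 * ?w \<sigma>)"
    proof -
      have "(\<Sum>\<sigma>\<in>P. (?d \<sigma>)\<^sup>2 * ?w (?\<tau> \<sigma> I J)) = (\<Sum>\<sigma>\<in>P. (?d (?\<tau> \<sigma> I J))\<^sup>2 * ?w (?\<tau> \<sigma> I J))"
        by (simp add: invol power2_commute)
      also have "\<dots> = (\<Sum>\<sigma>\<in>P. (?d \<sigma>)\<^sup>2 * ?w \<sigma>)"
        by (rule swap[OF IJ, of "\<lambda>\<sigma>. (?d \<sigma>)\<^sup>2 * ?w \<sigma>"])
      finally show ?thesis .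
    qed
    have "(\<Sum>\<sigma>\<in>P. - l * (?d \<sigma>)\<^sup>2 * (?w \<sigma> + ?w (?\<tau> \<sigma> I J))) \<le>
        (\<Sum>\<sigma>\<in>P. ?d \<sigma> * (?w \<sigma> - ?w (?\<tau> \<sigma> I J)))"
      by (intro sum_mono exp_secant_bound assms)
    also have "(\<Sum>\<sigma>\<in>P. ?d \<sigma> * (?w \<sigma> - ?w (?\<tau> \<sigma> I J))) = 2 * (\<Sum>\<sigma>\<in>P. ?d \<sigma> * ?w \<sigma>)"
      using A by (simp only: right_diff_distrib sum_subtractf)
    also have "(\<Sum>\<sigma>\<in>P. - l * (?d \<sigma>)\<^sup>2 * (?w \<sigma> + ?w (?\<tau> \<sigma> I J))) =
        - l * ((\<Sum>\<sigma>\<in>P. (?d \<sigma>)\<^sup>2 * ?w \<sigma>) + (\<Sum>\<sigma>\<in>P. (?d \<sigma>)\<^sup>2 * ?w (?\<tau> \<sigma> I J)))"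
      by (simp only: sum_distrib_left distrib_left sum.distrib mult.assoc)
    finally have double: "- l * ((\<Sum>\<sigma>\<in>P. (?d \<sigma>)\<^sup>2 * ?w \<sigma>) + (\<Sum>\<sigma>\<in>P. (?d \<sigma>)\<^sup>2 * ?w \<sigma>)) \<le>
        2 * (\<Sum>\<sigma>\<in>P. ?d \<sigma> * ?w \<sigma>)" unfolding B .
    have "- l * x \<le> y" if "- l * (x + x) \<le> 2 * y" for x y
      using that by (simp add: algebra_simps)
    then show ?thesis using double .
  qed
  have "- l * (\<Sum>\<sigma>\<in>P. 4 * ?n * (X \<sigma> + \<mu>) * ?w \<sigma>) \<le>
      - l * (\<Sum>\<sigma>\<in>P. (\<Sum>I\<in>S. \<Sum>J\<in>S. (X \<sigma> - X (?\<tau> \<sigma> I J))\<^sup>2) * ?w \<sigma>)"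
    using assms(3) spread by (intro mult_left_mono_neg sum_mono mult_right_mono) auto
  also have "\<dots> = (\<Sum>I\<in>S. \<Sum>J\<in>S. - l * (\<Sum>\<sigma>\<in>P. (X \<sigma> - X (?\<tau> \<sigma> I J))\<^sup>2 * ?w \<sigma>))"
    unfolding sum_distrib_right
    by (subst sum.swap, subst sum.swap[of _ S P]) (simp only: sum_distrib_left)
  also have "\<dots> \<le> (\<Sum>I\<in>S. \<Sum>J\<in>S. \<Sum>\<sigma>\<in>P. (X \<sigma> - X (?\<tau> \<sigma> I J)) * ?w \<sigma>)"
    by (intro sum_mono pair)
  also have "\<dots> = (\<Sum>\<sigma>\<in>P. (\<Sum>I\<in>S. \<Sum>J\<in>S. X \<sigma> - X (?\<tau> \<sigma> I J)) * ?w \<sigma>)"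
    unfolding sum_distrib_right
    by (subst (2) sum.swap, subst sum.swap[of _ S P]) (rule refl)
  also have "\<dots> = (\<Sum>\<sigma>\<in>P. 2 * ?n * (X \<sigma> - \<mu>) * ?w \<sigma>)"
    by (intro sum.cong refl) (simp add: drift)
  finally have bound: "- l * (\<Sum>\<sigma>\<in>P. 4 * ?n * (X \<sigma> + \<mu>) * ?w \<sigma>) \<le> (\<Sum>\<sigma>\<in>P. 2 * ?n * (X \<sigma> - \<mu>) * ?w \<sigma>)" .
  have factor: "(\<Sum>\<sigma>\<in>P. 4 * ?n * (X \<sigma> + \<mu>) * ?w \<sigma>) = 4 * ?n * (\<Sum>\<sigma>\<in>P. (X \<sigma> + \<mu>) * ?w \<sigma>)"
    "(\<Sum>\<sigma>\<in>P. 2 * ?n * (X \<sigma> - \<mu>) * ?w \<sigma>) = 2 * ?n * (\<Sum>\<sigma>\<in>P. (X \<sigma> - \<mu>) * ?w \<sigma>)"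
    by (simp_all only: sum_distrib_left mult.assoc)
  have cancel: "- 2 * l * x \<le> y" if "- l * (4 * ?n * x) \<le> 2 * ?n * y" for x y
  proof -
    have "(2 * ?n) * (- 2 * l * x) \<le> (2 * ?n) * y" using that by (simp add: mult_ac)
    then show ?thesis using n by (subst (asm) mult_le_cancel_left_pos) auto
  qed
  show ?thesis using bound unfolding factor by (rule cancel)
qed

text \<open>
  The left hand side, as a function \<open>g\<close> of \<open>l\<close>, has derivative \<open>- A\<close> with \<open>A\<close> the sum of
  \<open>X \<sigma> * exp (- l * X \<sigma>)\<close>.  The exchangeable pair inequality relates \<open>A\<close> to \<open>g\<close>; it becomes the
  differential inequality \<open>g' \<le> - \<mu> (1 - 4 l) g\<close>, which is integrated from \<open>0\<close>.
\<close>

lemma sum_exp_permutation_le: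
  fixes a :: "'a \<Rightarrow> 'a \<Rightarrow> real"
  assumes "finite S" "S \<noteq> {}" "0 \<le> l"
    and a: "\<And>i j. i \<in> S \<Longrightarrow> j \<in> S \<Longrightarrow> 0 \<le> a i j \<and> a i j \<le> 1"
  defines "P \<equiv> {\<sigma>. \<sigma> permutes S}"
    and "X \<equiv> \<lambda>\<sigma>. \<Sum>i\<in>S. a i (\<sigma> i)"
    and "\<mu> \<equiv> (\<Sum>i\<in>S. \<Sum>j\<in>S. a i j) / card S"
  shows "(\<Sum>\<sigma>\<in>P. exp (- l * X \<sigma>)) \<le> card P * exp (- \<mu> * l + 2 * \<mu> * l\<^sup>2)"
proof -
  define g where "g x = (\<Sum>\<sigma>\<in>P. exp (- x * X \<sigma>))" for x
  define A where "A x = (\<Sum>\<sigma>\<in>P. X \<sigma> * exp (- x * X \<sigma>))" for x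
  have \<mu>: "0 \<le> \<mu>" unfolding \<mu>_def using a by (intro divide_nonneg_nonneg sum_nonneg) auto
  have g: "0 \<le> g x" for x unfolding g_def by (intro sum_nonneg) auto
  have key: "\<mu> * g x * (1 - 4 * x) \<le> A x" if x: "0 \<le> x" for x
  proof -
    have "- 2 * x * (A x + \<mu> * g x) \<le> A x - \<mu> * g x"
      using exchangeable_pair_inequality[OF assms(1,2) x a]
      by (simp add: A_def g_def P_def X_def \<mu>_def distrib_right left_diff_distrib sum.distrib
          sum_subtractf sum_distrib_left)
    then have "\<mu> * g x * (1 - 2 * x) \<le> A x * (1 + 2 * x)" by (simp add: algebra_simps)
    moreover have "\<mu> * g x * ((1 - 4 * x) * (1 + 2 * x)) \<le> \<mu> * g x * (1 - 2 * x)"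
      using \<mu> g x by (intro mult_left_mono) (auto simp: algebra_simps)
    ultimately have "\<mu> * g x * (1 - 4 * x) * (1 + 2 * x) \<le> A x * (1 + 2 * x)"
      by (simp only: mult.assoc) 
    then show ?thesis using x by (subst (asm) mult_le_cancel_right_pos) auto
  qed
  define h where "h x = g x * exp (\<mu> * x - 2 * \<mu> * x\<^sup>2)" for x
  have "h l \<le> h 0"
  proof (rule DERIV_nonpos_imp_nonincreasing[OF assms(3)])
    fix x assume x: "0 \<le> x" "x \<le> l"
    have dg: "(g has_real_derivative - A x) (at x)"
      unfolding g_def A_def
      by (auto intro!: derivative_eq_intros sum.cong simp: sum_negf[symmetric])
    have "(h has_real_derivative (\<mu> * g x * (1 - 4 * x) - A x) * exp (\<mu> * x - 2 * \<mu> * x\<^sup>2)) (at x)"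
      unfolding h_def by (rule derivative_eq_intros dg refl | simp add: algebra_simps)+
    then show "\<exists>y. (h has_real_derivative y) (at x) \<and> y \<le> 0"
      using key[OF x(1)] by (intro exI conjI) (auto intro: mult_nonpos_nonneg)
  qed
  also have "h 0 = card P" by (simp add: h_def g_def)
  finally have "h l * exp (- \<mu> * l + 2 * \<mu> * l\<^sup>2) \<le> card P * exp (- \<mu> * l + 2 * \<mu> * l\<^sup>2)"
    by (rule mult_right_mono) simp
  then show ?thesis by (simp add: h_def mult.assoc flip: exp_add) (simp add: g_def)
qed

text \<open>
  Chernoff's argument with the exponential moment just bounded, at the optimal \<open>l = \<delta> / 4\<close>.
\<close>

lemma permutation_lower_tail:
  fixes a :: "'a \<Rightarrow> 'a \<Rightarrow> real"
  assumes "finite S" "S \<noteq> {}" "0 \<le> \<delta>"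
    and a: "\<And>i j. i \<in> S \<Longrightarrow> j \<in> S \<Longrightarrow> 0 \<le> a i j \<and> a i j \<le> 1"
  defines "\<mu> \<equiv> (\<Sum>i\<in>S. \<Sum>j\<in>S. a i j) / card S"
  shows "card {\<sigma>. \<sigma> permutes S \<and> (\<Sum>i\<in>S. a i (\<sigma> i)) \<le> (1 - \<delta>) * \<mu>} \<le> fact (card S) * exp (- \<mu> * \<delta>\<^sup>2 / 8)"
proof -
  define X where "X \<sigma> = (\<Sum>i\<in>S. a i (\<sigma> i))" for \<sigma>
  define P where "P = {\<sigma>. \<sigma> permutes S}"
  define Q where "Q = {\<sigma>. \<sigma> permutes S \<and> X \<sigma> \<le> (1 - \<delta>) * \<mu>}"
  let ?l = "\<delta> / 4"
  have finP: "finite P" and QP: "Q \<subseteq> P" and cP: "card P = fact (card S)"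
    using assms(1) by (auto simp: P_def Q_def finite_permutations card_permutations)
  have "card Q * exp (- ?l * ((1 - \<delta>) * \<mu>)) \<le> (\<Sum>\<sigma>\<in>Q. exp (- ?l * X \<sigma>))"
    using assms(3) by (intro sum_bounded_below) (auto simp: Q_def mult_left_mono)
  also have "\<dots> \<le> (\<Sum>\<sigma>\<in>P. exp (- ?l * X \<sigma>))"
    using finP QP by (intro sum_mono2) auto
  also have "\<dots> \<le> card P * exp (- \<mu> * ?l + 2 * \<mu> * ?l\<^sup>2)"
    using sum_exp_permutation_le[OF assms(1,2) _ a, of ?l] assms(3) by (simp add: P_def X_def \<mu>_def)
  finally have "card Q * exp (- ?l * ((1 - \<delta>) * \<mu>)) * exp (?l * ((1 - \<delta>) * \<mu>)) \<le>
      card P * exp (- \<mu> * ?l + 2 * \<mu> * ?l\<^sup>2) * exp (?l * ((1 - \<delta>) * \<mu>))"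
    by (rule mult_right_mono) simp
  then have "card Q \<le> card P * exp (- \<mu> * ?l + 2 * \<mu> * ?l\<^sup>2 + ?l * ((1 - \<delta>) * \<mu>))"
    by (simp add: mult.assoc flip: exp_add)
  also have "- \<mu> * ?l + 2 * \<mu> * ?l\<^sup>2 + ?l * ((1 - \<delta>) * \<mu>) = - \<mu> * \<delta>\<^sup>2 / 8"
    by (simp add: field_simps power2_eq_square)
  finally show ?thesis by (simp add: Q_def X_def cP)
qed

section \<open>From a good permutation to a rainbow matching\<close>

lemma degree_eq_card_neighbours:
  assumes "E \<subseteq> all_edges V"
  shows "degree E v = card {u \<in> V. {v, u} \<in> E}"
  unfolding degree_def
proof (rule bij_betw_same_card[symmetric, of "\<lambda>u. {v, u}"], rule bij_betw_imageI)
  show "inj_on (\<lambda>u. {v, u}) {u \<in> V. {v, u} \<in> E}"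
    by (auto simp: inj_on_def doubleton_eq_iff)
  have "\<exists>u\<in>V. e = {v, u}" if "e \<in> E" "v \<in> e" for e
  proof -
    have e: "e \<subseteq> V" "card e = 2" using assms that(1) by (auto simp: all_edges_def)
    then obtain x y where "e = {x, y}" by (auto simp: card_2_iff)
    then show ?thesis using e(1) that(2) by auto
  qed
  then show "(\<lambda>u. {v, u}) ` {u \<in> V. {v, u} \<in> E} = {e \<in> E. v \<in> e}" by auto
qed

text \<open>
  Half of the vertices of \<open>V\<close>, at the positions \<open>I\<close>, are drawn at random, and position \<open>i\<close> carries the
  graph \<open>H i\<close>.  About half of the degree of \<open>v\<close> survives.  This one statement serves both sides of
  the bipartite graph: for a vertex on the left all \<open>H i\<close> are the single graph of that vertex, while
  for a vertex on the right the graphs vary with the position.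
\<close>

lemma permuted_degree_lower_tail:
  fixes H :: "'a \<Rightarrow> 'a set set" and K \<delta> :: real
  assumes "finite V" "V \<noteq> {}" "I \<subseteq> V" "card V = 2 * card I" and d: "0 \<le> \<delta>" "\<delta> \<le> 1"
    and H: "\<And>i. i \<in> I \<Longrightarrow> H i \<subseteq> all_edges V"
    and K: "\<And>i. i \<in> I \<Longrightarrow> K \<le> degree (H i) v"
  shows "card {\<sigma>. \<sigma> permutes V \<and> card {i \<in> I. {v, \<sigma> i} \<in> H i} \<le> (1 - \<delta>) * (K / 2)}
    \<le> fact (card V) * exp (- K * \<delta>\<^sup>2 / 16)"
proof -
  define a :: "'a \<Rightarrow> 'a \<Rightarrow> real" where "a i u = of_bool (i \<in> I \<and> {v, u} \<in> H i)" for i u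
  define \<mu> where "\<mu> = (\<Sum>i\<in>V. \<Sum>j\<in>V. a i j) / card V"
  have finI: "finite I" using assms by (auto intro: finite_subset)
  have X: "(\<Sum>i\<in>V. a i (\<sigma> i)) = card {i \<in> I. {v, \<sigma> i} \<in> H i}" for \<sigma>
  proof -
    have "(\<Sum>i\<in>V. a i (\<sigma> i)) = (\<Sum>i\<in>V. of_bool (i \<in> {i \<in> I. {v, \<sigma> i} \<in> H i}))"
      by (simp add: a_def)
    also have "\<dots> = card {i \<in> I. {v, \<sigma> i} \<in> H i}"
      using assms(1,3) by (subst sum_of_bool_eq) (auto intro!: arg_cong[of _ _ card])
    finally show ?thesis .
  qed
  have "card I * K \<le> (\<Sum>i\<in>I. real (degree (H i) v))"
    using K by (intro sum_bounded_below) auto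
  also have "\<dots> = (\<Sum>i\<in>I. \<Sum>j\<in>V. a i j)"
  proof (rule sum.cong[OF refl])
    fix i assume i: "i \<in> I"
    show "real (degree (H i) v) = (\<Sum>j\<in>V. a i j)"
      unfolding degree_eq_card_neighbours[OF H[OF i]] using i assms(1)
      by (simp add: a_def sum_of_bool_eq Int_def)
  qed
  also have "\<dots> = (\<Sum>i\<in>V. \<Sum>j\<in>V. a i j)"
    using assms(1,3) by (intro sum.mono_neutral_left) (auto simp: a_def)
  finally have "card I * K \<le> (\<Sum>i\<in>V. \<Sum>j\<in>V. a i j)" .
  moreover have "0 < card I" using assms(1,2,4) by (metis card_gt_0_iff nat_0_less_mult_iff)
  ultimately have \<mu>: "K / 2 \<le> \<mu>"
    using assms(4) by (simp add: \<mu>_def field_simps)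
  have "card {\<sigma>. \<sigma> permutes V \<and> card {i \<in> I. {v, \<sigma> i} \<in> H i} \<le> (1 - \<delta>) * (K / 2)} \<le>
      card {\<sigma>. \<sigma> permutes V \<and> (\<Sum>i\<in>V. a i (\<sigma> i)) \<le> (1 - \<delta>) * \<mu>}"
  proof (rule card_mono)
    show "finite {\<sigma>. \<sigma> permutes V \<and> (\<Sum>i\<in>V. a i (\<sigma> i)) \<le> (1 - \<delta>) * \<mu>}"
      using finite_permutations[OF assms(1)] by (rule rev_finite_subset) auto
    have "(1 - \<delta>) * (K / 2) \<le> (1 - \<delta>) * \<mu>" using \<mu> d by (intro mult_left_mono) auto
    then show "{\<sigma>. \<sigma> permutes V \<and> card {i \<in> I. {v, \<sigma> i} \<in> H i} \<le> (1 - \<delta>) * (K / 2)} \<subseteq>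
        {\<sigma>. \<sigma> permutes V \<and> (\<Sum>i\<in>V. a i (\<sigma> i)) \<le> (1 - \<delta>) * \<mu>}"
      unfolding X by force
  qed
  also have "\<dots> \<le> fact (card V) * exp (- \<mu> * \<delta>\<^sup>2 / 8)"
    unfolding \<mu>_def by (rule permutation_lower_tail[OF assms(1,2) d(1)]) (auto simp: a_def)
  also have "\<dots> \<le> fact (card V) * exp (- K * \<delta>\<^sup>2 / 16)"
    using mult_right_mono[OF \<mu>, of "\<delta>\<^sup>2"] by simp
  finally show ?thesis by simp
qed

text \<open>
  The edge through position \<open>i\<close> takes colour \<open>i\<close>, so each colour is used once.
\<close>

lemma rainbow_perfect_matching_from_bijection:
  assumes \<sigma>: "\<sigma> permutes {1..2 * m}" and f: "bij_betw f {1..m} {m + 1..2 * m}"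
    and H: "\<And>i. i \<in> {1..m} \<Longrightarrow> {\<sigma> i, \<sigma> (f i)} \<in> H i"
  shows "admits_rainbow_perfect_matching {1..2 * m} m H"
proof -
  define e where "e i = {\<sigma> i, \<sigma> (f i)}" for i
  have inj\<sigma>: "\<sigma> x = \<sigma> y \<longleftrightarrow> x = y" for x y using permutes_inj[OF \<sigma>] by (auto dest: injD)
  have f_in: "m < f i" "f i \<le> 2 * m" if "i \<in> {1..m}" for i
    using bij_betwE[OF f] that by fastforce+
  have \<sigma>V: "\<sigma> i \<in> {1..2 * m}" if "i \<in> {1..2 * m}" for i
    using that by (simp only: permutes_in_image[OF \<sigma>])
  have e_in: "e i \<subseteq> {1..2 * m}" if "i \<in> {1..m}" for i
    using that f_in[OF that] \<sigma>V[of i] \<sigma>V[of "f i"] by (auto simp: e_def)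
  have disj: "disjnt (e i) (e j)" if "i \<in> {1..m}" "j \<in> {1..m}" "i \<noteq> j" for i j
    using that f_in[of i] f_in[of j] bij_betw_imp_inj_on[OF f]
    by (auto simp: e_def disjnt_iff inj\<sigma> inj_on_eq_iff)
  have inj: "inj_on e {1..m}"
    by (rule inj_onI) (metis disj disjnt_self_iff_empty e_def insert_not_empty)
  have "\<Union>(e ` {1..m}) = \<sigma> ` ({1..m} \<union> f ` {1..m})" by (auto simp: e_def)
  also have "{1..m} \<union> f ` {1..m} = {1..2 * m}" using bij_betw_imp_surj_on[OF f] by auto
  also have "\<sigma> ` {1..2 * m} = {1..2 * m}" by (rule permutes_image[OF \<sigma>])
  finally have cover: "\<Union>(e ` {1..m}) = {1..2 * m}" .
  have card_e: "card (e i) = 2" if "i \<in> {1..m}" for i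
    using that f_in[OF that] by (auto simp: e_def inj\<sigma> card_2_iff)
  have "perfect_matching {1..2 * m} (e ` {1..m})"
    unfolding perfect_matching_def
  proof (intro conjI)
    show "e ` {1..m} \<subseteq> all_edges {1..2 * m}" using e_in card_e unfolding all_edges_def by blast
    show "pairwise disjnt (e ` {1..m})"
    proof (rule pairwiseI)
      fix x y assume "x \<in> e ` {1..m}" "y \<in> e ` {1..m}" "x \<noteq> y"
      then obtain i j where "i \<in> {1..m}" "j \<in> {1..m}" "x = e i" "y = e j" "i \<noteq> j" by blast
      then show "disjnt x y" using disj by simp
    qed
  qed (rule cover)
  moreover have "rainbow m H (e ` {1..m})"
    unfolding rainbow_def
    by (rule exI[of _ "the_inv_into {1..m} e"])
      (use inj H in \<open>auto simp: the_inv_into_f_f e_def[symmetric] inj_on_the_inv_into\<close>)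
  ultimately show ?thesis unfolding admits_rainbow_perfect_matching_def by blast
qed

text \<open>
  A permutation \<open>\<sigma>\<close> of the \<open>2 * m\<close> vertices yields a bipartite graph between the positions \<open>{1..m}\<close> and
  \<open>{m + 1..2 * m}\<close>, in which \<open>i\<close> and \<open>j\<close> are joined when \<open>{\<sigma> i, \<sigma> j}\<close> is an edge of the graph \<open>G i\<close> of
  colour \<open>i\<close>.  A dense spot is the obstruction to a perfect matching in subgraphs of minimum
  degree \<open>D\<close> found above.
\<close>

definition dense_spot :: "nat \<Rightarrow> real \<Rightarrow> (nat \<Rightarrow> nat) \<Rightarrow> (nat \<Rightarrow> nat set set) \<Rightarrow> bool" where
  "dense_spot m D \<sigma> G \<longleftrightarrow> (\<exists>S\<subseteq>{1..m}. \<exists>T\<subseteq>{m + 1..2 * m}. (S \<noteq> {} \<or> T \<noteq> {}) \<and> card S + card T \<le> m \<and>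
    (card S + card T) / 2 * D \<le> card {(i, j) \<in> S \<times> T. {\<sigma> i, \<sigma> j} \<in> G i})"

text \<open>
  For a fixed family \<open>H\<close>, however it was chosen in view of \<open>G\<close>, fewer than half of the permutations
  have a dense spot and at most half of them spoil a degree.  So some permutation does neither, and
  the bipartite graph that it induces from \<open>H\<close> has a perfect matching.
\<close>

lemma rainbow_matching_if_few_dense_spots:
  fixes K \<delta> D :: real
  assumes "m > 0" "0 \<le> \<delta>" "\<delta> \<le> 1"
    and few: "card {\<sigma>. \<sigma> permutes {1..2 * m} \<and> dense_spot m D \<sigma> G} < fact (2 * m) / (2 :: real)"
    and G: "\<And>c. c \<in> {1..m} \<Longrightarrow> G c \<subseteq> all_edges {1..2 * m}"
    and H: "\<And>c. c \<in> {1..m} \<Longrightarrow> H c \<subseteq> G c"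
    and K: "\<And>c. c \<in> {1..m} \<Longrightarrow> K \<le> min_degree {1..2 * m} (H c)"
    and D: "D \<le> (1 - \<delta>) * (K / 2)"
    and small: "(2 * m)\<^sup>2 * exp (- K * \<delta>\<^sup>2 / 16) \<le> 1 / 2"
  shows "admits_rainbow_perfect_matching {1..2 * m} m H"
proof -
  let ?V = "{1..2 * m}" and ?L = "{1..m}" and ?R = "{m + 1..2 * m}"
  let ?q = "fact (2 * m) * exp (- K * \<delta>\<^sup>2 / 16)"
  define P where "P = {\<sigma>. \<sigma> permutes ?V}"
  define A where "A = {\<sigma>. \<sigma> permutes ?V \<and> dense_spot m D \<sigma> G}"
  define B where "B c v = {\<sigma>. \<sigma> permutes ?V \<and> card {i \<in> ?R. {v, \<sigma> i} \<in> H c} \<le> (1 - \<delta>) * (K / 2)}" for c v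
  define C where "C v = {\<sigma>. \<sigma> permutes ?V \<and> card {i \<in> ?L. {v, \<sigma> i} \<in> H i} \<le> (1 - \<delta>) * (K / 2)}" for v
  have HV: "H c \<subseteq> all_edges ?V" if "c \<in> ?L" for c using G H that by blast
  have deg: "K \<le> degree (H c) v" if "c \<in> ?L" "v \<in> ?V" for c v
  proof -
    have "min_degree ?V (H c) \<le> degree (H c) v" unfolding min_degree_def using that by (intro Min_le) auto
    then show ?thesis using K[OF that(1)] by linarith
  qed
  have finP: "finite P" and cP: "card P = fact (2 * m)"
    by (simp_all add: P_def finite_permutations card_permutations)
  have B: "card (B c v) \<le> ?q" if "c \<in> ?L" "v \<in> ?V" for c v
    using permuted_degree_lower_tail[of ?V ?R \<delta> "\<lambda>_. H c" K v] assms(1-3) HV deg that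
    by (simp add: B_def)
  have C: "card (C v) \<le> ?q" if "v \<in> ?V" for v
    using permuted_degree_lower_tail[of ?V ?L \<delta> H K v] assms(1-3) HV deg that
    by (simp add: C_def)
  \<comment> \<open>There are \<open>m * 2m + 2m\<close> degrees to control, at most \<open>(2m)\<^sup>2\<close>.\<close>
  define Bad where "Bad = (\<Union>cv\<in>?L \<times> ?V. B (fst cv) (snd cv)) \<union> (\<Union>v\<in>?V. C v)"
  have "card Bad \<le> (\<Sum>cv\<in>?L \<times> ?V. card (B (fst cv) (snd cv))) + (\<Sum>v\<in>?V. card (C v))"
    unfolding Bad_def by (intro order.trans[OF card_Un_le] add_mono card_UN_le) auto
  also have "real \<dots> \<le> (\<Sum>cv\<in>?L \<times> ?V. ?q) + (\<Sum>v\<in>?V. ?q)"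
    unfolding of_nat_add of_nat_sum using B C by (intro add_mono sum_mono) auto
  also have "\<dots> = (m * (2 * m) + 2 * m) * ?q" by (simp add: algebra_simps)
  also have "\<dots> \<le> (2 * m)\<^sup>2 * ?q"
    using assms(1) by (intro mult_right_mono of_nat_mono) (auto simp: power2_eq_square)
  also have "\<dots> = fact (2 * m) * ((2 * m)\<^sup>2 * exp (- K * \<delta>\<^sup>2 / 16))" by simp
  also have "\<dots> \<le> fact (2 * m) * (1 / 2)" using small by (intro mult_left_mono) auto
  finally have "card Bad \<le> fact (2 * m) / (2 :: real)" by simp
  then have "real (card (A \<union> Bad)) < card P"
    using few card_Un_le[of A Bad] by (simp add: A_def cP)
  moreover have "finite (A \<union> Bad)"
    by (rule finite_subset[OF _ finP]) (auto simp: A_def B_def C_def Bad_def P_def)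
  ultimately have "\<not> P \<subseteq> A \<union> Bad" using card_mono[of "A \<union> Bad" P] by auto
  then obtain \<sigma> where \<sigma>: "\<sigma> permutes ?V" and nA: "\<not> dense_spot m D \<sigma> G"
    and nB: "\<And>c v. c \<in> ?L \<Longrightarrow> v \<in> ?V \<Longrightarrow> \<sigma> \<notin> B c v" and nC: "\<And>v. v \<in> ?V \<Longrightarrow> \<sigma> \<notin> C v"
    unfolding Bad_def P_def A_def by fastforce
  have \<sigma>V: "\<sigma> i \<in> ?V" if "i \<in> ?V" for i using that by (simp only: permutes_in_image[OF \<sigma>])
  have "\<exists>f. bij_betw f ?L ?R \<and> (\<forall>i\<in>?L. {\<sigma> i, \<sigma> (f i)} \<in> H i)"
  proof (rule perfect_matching_if_locally_sparse[where D = D and m = m])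
    show "D \<le> card {j \<in> ?R. {\<sigma> i, \<sigma> j} \<in> H i}" if "i \<in> ?L" for i
      using nB[of i "\<sigma> i"] \<sigma>V[of i] that D \<sigma> by (auto simp: B_def)
    show "D \<le> card {i \<in> ?L. {\<sigma> i, \<sigma> j} \<in> H i}" if "j \<in> ?R" for j
      using nC[of "\<sigma> j"] \<sigma>V[of j] that D \<sigma> by (auto simp: C_def insert_commute)
    fix S T assume ST: "S \<subseteq> ?L" "T \<subseteq> ?R" "S \<noteq> {} \<or> T \<noteq> {}" "card S + card T \<le> m"
    have "finite S" "finite T" using ST by (auto intro: finite_subset)
    moreover have "H i \<subseteq> G i" if "i \<in> S" for i using H ST(1) that by blast
    ultimately have "card {(i, j) \<in> S \<times> T. {\<sigma> i, \<sigma> j} \<in> H i} \<le> card {(i, j) \<in> S \<times> T. {\<sigma> i, \<sigma> j} \<in> G i}"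
      by (intro card_mono finite_subset[OF _ finite_cartesian_product[of S T]]) auto
    moreover have "card {(i, j) \<in> S \<times> T. {\<sigma> i, \<sigma> j} \<in> G i} < (card S + card T) / 2 * D"
      using nA ST unfolding dense_spot_def by (meson not_less)
    ultimately show "card {(i, j) \<in> S \<times> T. {\<sigma> i, \<sigma> j} \<in> H i} < (card S + card T) / 2 * D"
      by linarith
  qed auto
  then show ?thesis using rainbow_perfect_matching_from_bijection[OF \<sigma>] by blast
qed

section \<open>Dense spots are rare in random graphs\<close>

lemma finite_all_edges: "finite V \<Longrightarrow> finite (all_edges V)"
  unfolding all_edges_def by (rule finite_subset[of _ "Pow V"]) auto

lemma set_binomial_random_graph: "set_pmf (binomial_random_graph n p) \<subseteq> Pow (all_edges {1..n})"
  by (auto simp: binomial_random_graph_def)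

lemma finite_set_binomial_random_graph: "finite (set_pmf (binomial_random_graph n p))"
  using set_binomial_random_graph by (rule finite_subset) (simp add: finite_all_edges)

lemma set_random_graph_family:
  assumes "G \<in> set_pmf (random_graph_family m n p)" "c \<in> {1..m}"
  shows "G c \<subseteq> all_edges {1..n}"
  using assms set_binomial_random_graph[of n p]
  by (auto simp: random_graph_family_def set_Pi_pmf PiE_dflt_def)

lemma finite_set_random_graph_family: "finite (set_pmf (random_graph_family m n p))"
  by (auto simp: random_graph_family_def set_Pi_pmf intro!: finite_PiE_dflt finite_set_binomial_random_graph)

lemma binomial_random_graph_exp_moment:
  fixes p l :: real
  assumes "0 \<le> p" "p \<le> 1" "A \<subseteq> all_edges {1..n}"
  shows "measure_pmf.expectation (binomial_random_graph n p) (\<lambda>E. exp (l * card (A \<inter> E)))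
    = (1 + p * (exp l - 1)) ^ card A"
proof -
  let ?U = "all_edges {1..n}"
  have fin: "finite ?U" by (simp add: finite_all_edges)
  have "measure_pmf.expectation (binomial_random_graph n p) (\<lambda>E. exp (l * card (A \<inter> E))) =
    measure_pmf.expectation (Pi_pmf ?U False (\<lambda>_. bernoulli_pmf p))
      (\<lambda>present. exp (l * card (A \<inter> {e \<in> ?U. present e})))"
    by (simp add: binomial_random_graph_def)
  also have "(\<lambda>present. exp (l * card (A \<inter> {e \<in> ?U. present e}))) =
      (\<lambda>present. \<Prod>e\<in>?U. if e \<in> A \<and> present e then exp l else 1)"
  proof
    fix present
    have "(\<Prod>e\<in>?U. if e \<in> A \<and> present e then exp l else 1) = (\<Prod>e\<in>A \<inter> {e \<in> ?U. present e}. exp l)"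
      using fin assms(3) by (intro prod.mono_neutral_cong_right) auto
    then show "exp (l * card (A \<inter> {e \<in> ?U. present e})) =
        (\<Prod>e\<in>?U. if e \<in> A \<and> present e then exp l else 1)"
      by (simp add: exp_of_nat2_mult)
  qed
  also have "measure_pmf.expectation (Pi_pmf ?U False (\<lambda>_. bernoulli_pmf p))
      (\<lambda>present. \<Prod>e\<in>?U. if e \<in> A \<and> present e then exp l else 1) =
    (\<Prod>e\<in>?U. measure_pmf.expectation (bernoulli_pmf p) (\<lambda>b. if e \<in> A \<and> b then exp l else 1))"
    using fin by (intro expectation_prod_Pi_pmf integrable_measure_pmf_finite) auto
  also have "\<dots> = (\<Prod>e\<in>?U. if e \<in> A then 1 + p * (exp l - 1) else 1)"
    using assms(1,2) by (intro prod.cong) (auto simp: algebra_simps)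
  also have "\<dots> = (\<Prod>e\<in>A. 1 + p * (exp l - 1))"
    using fin assms(3) by (intro prod.mono_neutral_cong_right) auto
  finally show ?thesis by simp
qed

text \<open>
  For a fixed \<open>\<sigma>\<close> the pairs \<open>(i, j)\<close> query distinct pairs of a colour and an edge, so that the number
  of edges between \<open>S\<close> and \<open>T\<close> is binomially distributed; this is its exponential moment.
\<close>

lemma cross_edge_exp_moment:
  fixes p l :: real
  assumes p: "0 \<le> p" "p \<le> 1" and \<sigma>: "\<sigma> permutes {1..2 * m}"
    and ST: "S \<subseteq> {1..m}" "T \<subseteq> {m + 1..2 * m}"
  shows "measure_pmf.expectation (random_graph_family m (2 * m) p)
      (\<lambda>G. exp (l * card {(i, j) \<in> S \<times> T. {\<sigma> i, \<sigma> j} \<in> G i}))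
    = (1 + p * (exp l - 1)) ^ (card S * card T)"
proof -
  define A where "A i = (\<lambda>j. {\<sigma> i, \<sigma> j}) ` T" for i
  have fin: "finite S" "finite T" using ST by (auto intro: finite_subset)
  have inj\<sigma>: "\<sigma> x = \<sigma> y \<longleftrightarrow> x = y" for x y using permutes_inj[OF \<sigma>] by (auto dest: injD)
  have \<sigma>V: "\<sigma> i \<in> {1..2 * m}" if "i \<in> {1..2 * m}" for i
    using that by (simp only: permutes_in_image[OF \<sigma>])
  have injA: "inj_on (\<lambda>j. {\<sigma> i, \<sigma> j}) T'" for i T'
    by (auto simp: inj_on_def doubleton_eq_iff inj\<sigma>)
  have A: "A i \<subseteq> all_edges {1..2 * m}" if "i \<in> S" for i
  proof -
    have "{\<sigma> i, \<sigma> j} \<in> all_edges {1..2 * m}" if "j \<in> T" for j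
    proof -
      have "i \<in> {1..2 * m}" "j \<in> {1..2 * m}" "i \<noteq> j" using ST \<open>i \<in> S\<close> \<open>j \<in> T\<close> by fastforce+
      then show ?thesis using \<sigma>V[of i] \<sigma>V[of j] by (simp add: all_edges_def inj\<sigma>)
    qed
    then show ?thesis by (auto simp: A_def)
  qed
  have count: "card {(i, j) \<in> S \<times> T. {\<sigma> i, \<sigma> j} \<in> G i} = (\<Sum>i\<in>S. card (A i \<inter> G i))" for G
  proof -
    have "{(i, j) \<in> S \<times> T. {\<sigma> i, \<sigma> j} \<in> G i} = (SIGMA i:S. {j \<in> T. {\<sigma> i, \<sigma> j} \<in> G i})" by auto
    also have "card \<dots> = (\<Sum>i\<in>S. card {j \<in> T. {\<sigma> i, \<sigma> j} \<in> G i})" using fin by simp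
    also have "\<dots> = (\<Sum>i\<in>S. card (A i \<inter> G i))"
    proof (rule sum.cong[OF refl])
      fix i assume "i \<in> S"
      have "A i \<inter> G i = (\<lambda>j. {\<sigma> i, \<sigma> j}) ` {j \<in> T. {\<sigma> i, \<sigma> j} \<in> G i}" by (auto simp: A_def)
      then show "card {j \<in> T. {\<sigma> i, \<sigma> j} \<in> G i} = card (A i \<inter> G i)"
        by (simp only: card_image[OF injA])
    qed
    finally show ?thesis .
  qed
  have factor: "exp (l * card {(i, j) \<in> S \<times> T. {\<sigma> i, \<sigma> j} \<in> G i}) =
      (\<Prod>i\<in>{1..m}. if i \<in> S then exp (l * card (A i \<inter> G i)) else 1)" for G
  proof -
    have "(\<Prod>i\<in>{1..m}. if i \<in> S then exp (l * card (A i \<inter> G i)) else 1) =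
        (\<Prod>i\<in>S. exp (l * card (A i \<inter> G i)))"
      using ST(1) by (intro prod.mono_neutral_cong_right) auto
    then show ?thesis using fin by (simp only: count sum_distrib_left of_nat_sum exp_sum)
  qed
  have "measure_pmf.expectation (random_graph_family m (2 * m) p)
      (\<lambda>G. exp (l * card {(i, j) \<in> S \<times> T. {\<sigma> i, \<sigma> j} \<in> G i})) =
    (\<Prod>i\<in>{1..m}. measure_pmf.expectation (binomial_random_graph (2 * m) p)
      (\<lambda>E. if i \<in> S then exp (l * card (A i \<inter> E)) else 1))"
    unfolding factor random_graph_family_def
    by (intro expectation_prod_Pi_pmf integrable_measure_pmf_finite finite_set_binomial_random_graph) auto
  also have "\<dots> = (\<Prod>i\<in>{1..m}. if i \<in> S then (1 + p * (exp l - 1)) ^ card T else 1)"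
  proof (intro prod.cong refl)
    fix i
    have "card (A i) = card T" unfolding A_def by (rule card_image[OF injA])
    then show "measure_pmf.expectation (binomial_random_graph (2 * m) p)
        (\<lambda>E. if i \<in> S then exp (l * card (A i \<inter> E)) else 1) =
        (if i \<in> S then (1 + p * (exp l - 1)) ^ card T else 1)"
      using binomial_random_graph_exp_moment[OF p A, of i l] by simp
  qed
  also have "\<dots> = (\<Prod>i\<in>S. (1 + p * (exp l - 1)) ^ card T)"
    using ST(1) by (intro prod.mono_neutral_cong_right) auto
  finally show ?thesis by (simp add: mult.commute flip: power_mult)
qed

text \<open>
  With \<open>w\<close> the total size of \<open>S\<close> and \<open>T\<close>, the mean number of edges is at most
  \<open>w\<^sup>2 / 4 * p \<le> (w / 2) * (m * p / 2)\<close>, by the arithmetic-geometric mean inequality and \<open>w \<le> m\<close>.  The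
  threshold exceeds this by a constant factor, and Chernoff's bound with parameter \<open>\<eta>\<close> applies.
\<close>

lemma cross_edge_upper_tail:
  fixes \<eta> :: real
  assumes p: "0 \<le> p" "p \<le> 1" and \<sigma>: "\<sigma> permutes {1..2 * m}" and \<eta>: "0 < \<eta>" "\<eta> \<le> 1"
    and ST: "S \<subseteq> {1..m}" "T \<subseteq> {m + 1..2 * m}" "card S + card T \<le> m"
  shows "measure_pmf.prob (random_graph_family m (2 * m) p)
      {G. (card S + card T) / 2 * ((1/2 + \<eta>) * m * p) \<le> card {(i, j) \<in> S \<times> T. {\<sigma> i, \<sigma> j} \<in> G i}}
    \<le> exp (- \<eta>\<^sup>2 * m * p / 4) ^ (card S + card T)"
proof -
  let ?M = "random_graph_family m (2 * m) p"
  let ?X = "\<lambda>G. card {(i, j) \<in> S \<times> T. {\<sigma> i, \<sigma> j} \<in> G i}"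
  let ?w = "real (card S + card T)"
  let ?t = "?w / 2 * ((1/2 + \<eta>) * m * p)"
  have "measure_pmf.prob ?M {G. ?t \<le> ?X G} = measure_pmf.prob ?M {G \<in> space ?M. exp (\<eta> * ?t) \<le> exp (\<eta> * ?X G)}"
    by (simp only: space_measure_pmf UNIV_I simp_thms exp_le_cancel_iff mult_le_cancel_left_pos[OF \<eta>(1)])
  also have "\<dots> \<le> measure_pmf.expectation ?M (\<lambda>G. exp (\<eta> * ?X G)) / exp (\<eta> * ?t)"
    by (intro integral_Markov_inequality_measure[where A = "{}"] integrable_measure_pmf_finite
        finite_set_random_graph_family) auto
  also have "\<dots> = (1 + p * (exp \<eta> - 1)) ^ (card S * card T) / exp (\<eta> * ?t)"
    using cross_edge_exp_moment[OF p \<sigma> ST(1,2), of \<eta>] by simp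
  also have "\<dots> \<le> exp (p * (\<eta> + \<eta>\<^sup>2)) ^ (card S * card T) / exp (\<eta> * ?t)"
  proof (intro divide_right_mono power_mono)
    have "p * (exp \<eta> - 1) \<le> p * (\<eta> + \<eta>\<^sup>2)"
      using p \<eta> exp_bound[of \<eta>] by (intro mult_left_mono) auto
    also have "1 + \<dots> \<le> exp (p * (\<eta> + \<eta>\<^sup>2))" by (rule exp_ge_add_one_self)
    finally show "1 + p * (exp \<eta> - 1) \<le> exp (p * (\<eta> + \<eta>\<^sup>2))" by simp
    show "0 \<le> 1 + p * (exp \<eta> - 1)" using p \<eta> by (intro add_nonneg_nonneg mult_nonneg_nonneg) auto
  qed simp
  also have "\<dots> = exp (card S * card T * (p * (\<eta> + \<eta>\<^sup>2)) - \<eta> * ?t)"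
    by (simp add: exp_diff flip: exp_of_nat_mult)
  also have "\<dots> \<le> exp (?w * (- \<eta>\<^sup>2 * m * p / 4))"
  proof -
    have "4 * (real (card S) * card T) = ?w * ?w - (real (card S) - card T)\<^sup>2"
      by (simp add: power2_eq_square algebra_simps)
    also have "\<dots> \<le> ?w * ?w" by simp
    also have "\<dots> \<le> ?w * m" using ST(3) by (intro mult_left_mono) auto
    finally have "card S * card T * (p * (\<eta> + \<eta>\<^sup>2)) \<le> ?w * m / 4 * (p * (\<eta> + \<eta>\<^sup>2))"
      using p \<eta> by (intro mult_right_mono) auto
    also have "\<dots> - \<eta> * ?t = ?w * (- \<eta>\<^sup>2 * m * p / 4)"
      by (simp add: field_simps power2_eq_square)
    finally show ?thesis by simp
  qed
  finally show ?thesis by (simp flip: exp_of_nat_mult)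
qed

text \<open>
  The union bound over all nonempty \<open>S \<union> T\<close>.  As the individual bounds are multiplicative in the
  vertices, their sum is that of \<open>q ^ card W\<close> over the nonempty subsets \<open>W\<close> of a set of \<open>2 * m\<close> elements.
\<close>

lemma prob_dense_spot:
  fixes \<eta> :: real
  assumes p: "0 \<le> p" "p \<le> 1" and \<sigma>: "\<sigma> permutes {1..2 * m}" and \<eta>: "0 < \<eta>" "\<eta> \<le> 1"
  shows "measure_pmf.prob (random_graph_family m (2 * m) p) {G. dense_spot m ((1/2 + \<eta>) * m * p) \<sigma> G}
    \<le> (1 + exp (- \<eta>\<^sup>2 * m * p / 4)) ^ (2 * m) - 1"
proof -
  let ?M = "random_graph_family m (2 * m) p" and ?D = "(1/2 + \<eta>) * m * p"
  let ?L = "{1..m}" and ?R = "{m + 1..2 * m}"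
  define q where "q = exp (- \<eta>\<^sup>2 * m * p / 4)"
  define I where "I = Pow ?L \<times> Pow ?R - {({}, {})}"
  define W where "W = {ST \<in> I. card (fst ST) + card (snd ST) \<le> m}"
  define B where "B ST = {G. (card (fst ST) + card (snd ST)) / 2 * ?D
    \<le> card {(i, j) \<in> fst ST \<times> snd ST. {\<sigma> i, \<sigma> j} \<in> G i}}" for ST
  have fin: "finite I" "finite W" by (auto simp: I_def W_def)
  have "{G. dense_spot m ?D \<sigma> G} \<subseteq> (\<Union>ST\<in>W. B ST)"
  proof
    fix G assume "G \<in> {G. dense_spot m ?D \<sigma> G}"
    then obtain S T where "S \<subseteq> ?L" "T \<subseteq> ?R" "S \<noteq> {} \<or> T \<noteq> {}" "card S + card T \<le> m"
      "(card S + card T) / 2 * ?D \<le> card {(i, j) \<in> S \<times> T. {\<sigma> i, \<sigma> j} \<in> G i}"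
      unfolding dense_spot_def by blast
    then have "(S, T) \<in> W" "G \<in> B (S, T)" by (simp_all add: W_def I_def B_def)
    then show "G \<in> (\<Union>ST\<in>W. B ST)" by blast
  qed
  then have "measure_pmf.prob ?M {G. dense_spot m ?D \<sigma> G} \<le> measure_pmf.prob ?M (\<Union>ST\<in>W. B ST)"
    by (intro measure_pmf.finite_measure_mono) auto
  also have "\<dots> \<le> (\<Sum>ST\<in>W. measure_pmf.prob ?M (B ST))"
    using fin by (intro measure_pmf.finite_measure_subadditive_finite) auto
  also have "\<dots> \<le> (\<Sum>ST\<in>W. q ^ (card (fst ST) + card (snd ST)))"
    unfolding B_def q_def by (intro sum_mono cross_edge_upper_tail assms) (auto simp: W_def I_def)
  also have "\<dots> \<le> (\<Sum>ST\<in>I. q ^ (card (fst ST) + card (snd ST)))"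
    using fin by (intro sum_mono2) (auto simp: W_def q_def)
  also have "\<dots> = (\<Sum>ST\<in>Pow ?L \<times> Pow ?R. q ^ card (fst ST) * q ^ card (snd ST)) - 1"
    unfolding I_def by (subst sum_diff) (auto simp: power_add)
  also have "(\<Sum>ST\<in>Pow ?L \<times> Pow ?R. q ^ card (fst ST) * q ^ card (snd ST)) =
      (\<Sum>S\<in>Pow ?L. q ^ card S) * (\<Sum>T\<in>Pow ?R. q ^ card T)"
    by (simp add: sum_product sum.cartesian_product case_prod_beta)
  also have "\<dots> = (1 + q) ^ (2 * m)"
  proof -
    have "(\<Sum>S\<in>Pow U. q ^ card S) = (1 + q) ^ card U" if "finite U" for U :: "nat set"
      using prod_add[OF that, of "\<lambda>_. q" "\<lambda>_. 1"] by (simp add: add.commute)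
    then show ?thesis by (simp add: power_add[symmetric] mult_2)
  qed
  finally show ?thesis by (simp add: q_def)
qed

text \<open>
  Markov's inequality for the number of permutations with a dense spot.  It turns the bound for each
  fixed permutation into a property of \<open>G\<close> alone, valid before any family \<open>H\<close> is chosen.
\<close>

lemma prob_many_dense_spots:
  fixes \<eta> :: real
  assumes p: "0 \<le> p" "p \<le> 1" and \<eta>: "0 < \<eta>" "\<eta> \<le> 1"
  shows "measure_pmf.prob (random_graph_family m (2 * m) p)
      {G. fact (2 * m) / 2 \<le> real (card {\<sigma>. \<sigma> permutes {1..2 * m} \<and> dense_spot m ((1/2 + \<eta>) * m * p) \<sigma> G})}
    \<le> 2 * ((1 + exp (- \<eta>\<^sup>2 * m * p / 4)) ^ (2 * m) - 1)"
proof -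
  let ?M = "random_graph_family m (2 * m) p" and ?D = "(1/2 + \<eta>) * m * p"
  let ?\<beta> = "(1 + exp (- \<eta>\<^sup>2 * m * p / 4)) ^ (2 * m) - 1"
  let ?N = "fact (2 * m) :: real"
  define P where "P = {\<sigma>. \<sigma> permutes {1..2 * m}}"
  define X where "X G = (\<Sum>\<sigma>\<in>P. indicat_real {G. dense_spot m ?D \<sigma> G} G)" for G
  have finP: "finite P" and cP: "card P = fact (2 * m)"
    by (simp_all add: P_def finite_permutations card_permutations)
  have X: "real (card {\<sigma>. \<sigma> permutes {1..2 * m} \<and> dense_spot m ?D \<sigma> G}) = X G" for G
  proof -
    have "X G = (\<Sum>\<sigma>\<in>P. of_bool (dense_spot m ?D \<sigma> G))"
      unfolding X_def by (intro sum.cong) (auto simp: indicator_def)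
    then show ?thesis using finP by (simp add: sum_of_bool_eq P_def Int_def)
  qed
  have "measure_pmf.prob ?M {G. ?N / 2 \<le> X G} = measure_pmf.prob ?M {G \<in> space ?M. ?N / 2 \<le> X G}" by simp
  also have "\<dots> \<le> measure_pmf.expectation ?M X / (?N / 2)"
    by (intro integral_Markov_inequality_measure[where A = "{}"] integrable_measure_pmf_finite
        finite_set_random_graph_family) (auto simp: X_def intro!: sum_nonneg)
  also have "\<dots> \<le> ?N * ?\<beta> / (?N / 2)"
  proof (rule divide_right_mono)
    have "measure_pmf.expectation ?M X = (\<Sum>\<sigma>\<in>P. measure_pmf.prob ?M {G. dense_spot m ?D \<sigma> G})"
      unfolding X_def
      by (subst Bochner_Integration.integral_sum)
        (auto intro!: integrable_measure_pmf_finite finite_set_random_graph_family)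
    also have "\<dots> \<le> (\<Sum>\<sigma>\<in>P. ?\<beta>)"
      by (intro sum_mono prob_dense_spot assms) (auto simp: P_def)
    also have "\<dots> = ?N * ?\<beta>" by (simp add: cP)
    finally show "measure_pmf.expectation ?M X \<le> ?N * ?\<beta>" .
  qed simp
  also have "?N * ?\<beta> / (?N / 2) = 2 * ?\<beta>" by (simp only: divide_divide_eq_right) simp
  finally show ?thesis unfolding X .
qed

section \<open>Resilience with high probability\<close>

text \<open>
  The excess \<open>\<epsilon>\<close> in the degrees is split: \<open>\<delta> = \<epsilon> / 3\<close> pays for the loss in the random bipartition, as
  \<open>(1 - \<epsilon> / 3) * (1 / 2 + \<epsilon>) \<ge> 1 / 2 + \<epsilon> / 2\<close> for \<open>\<epsilon> \<le> 1\<close>, and the remaining \<open>\<eta> = \<epsilon> / 2\<close> beats the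
  fluctuations of \<open>G\<close>.  The two resulting exponential bounds are at most \<open>q\<close>.
\<close>

lemma rainbow_resilience_prob:
  fixes \<epsilon> p :: real
  assumes \<epsilon>: "0 < \<epsilon>" "\<epsilon> < 1" and p: "0 \<le> p" "p \<le> 1" and "m > 0"
  defines "q \<equiv> exp (- \<epsilon>\<^sup>2 * m * p / 144)"
  assumes small: "(2 * real m)\<^sup>2 * q \<le> 1 / 2"
  shows "1 - 2 * ((1 + q) ^ (2 * m) - 1) \<le> measure_pmf.prob (random_graph_family m (2 * m) p)
    {G. \<forall>H. (\<forall>c\<in>{1..m}. H c \<subseteq> G c \<and> real (min_degree {1..2 * m} (H c)) \<ge> (1/2 + \<epsilon>) * real (2 * m) * p)
      \<longrightarrow> admits_rainbow_perfect_matching {1..2 * m} m H}"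
    (is "_ \<le> measure_pmf.prob ?M ?Good")
proof -
  let ?\<eta> = "\<epsilon> / 2" and ?\<delta> = "\<epsilon> / 3" and ?K = "(1/2 + \<epsilon>) * real (2 * m) * p"
  define D where "D = (1/2 + ?\<eta>) * m * p"
  define Many where "Many = {G. fact (2 * m) / 2 \<le>
    real (card {\<sigma>. \<sigma> permutes {1..2 * m} \<and> dense_spot m D \<sigma> G})}"
  have mp: "0 \<le> m * p" using p by simp
  have D: "D \<le> (1 - ?\<delta>) * (?K / 2)"
  proof -
    have "1/2 + ?\<eta> \<le> (1 - ?\<delta>) * (1/2 + \<epsilon>)"
    proof -
      have "\<epsilon> * \<epsilon> \<le> \<epsilon> * 1" using \<epsilon> by (intro mult_left_mono) auto
      then show ?thesis by (simp add: field_simps)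
    qed
    from mult_right_mono[OF this mp] show ?thesis by (simp add: D_def field_simps)
  qed
  have small': "(2 * m)\<^sup>2 * exp (- ?K * ?\<delta>\<^sup>2 / 16) \<le> 1 / 2"
  proof -
    have "1 * (\<epsilon>\<^sup>2 * (m * p)) \<le> (1 + 2 * \<epsilon>) * (\<epsilon>\<^sup>2 * (m * p))"
      using \<epsilon> mp by (intro mult_right_mono) auto
    then have "exp (- ?K * ?\<delta>\<^sup>2 / 16) \<le> q"
      unfolding q_def exp_le_cancel_iff by (simp add: field_simps power2_eq_square)
    then have "(2 * real m)\<^sup>2 * exp (- ?K * ?\<delta>\<^sup>2 / 16) \<le> (2 * real m)\<^sup>2 * q"
      by (intro mult_left_mono) auto
    with small show ?thesis by simp
  qed
  have "- Many \<inter> set_pmf ?M \<subseteq> ?Good"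
  proof safe
    fix G H
    assume G: "G \<notin> Many" "G \<in> set_pmf ?M"
      and H: "\<forall>c\<in>{1..m}. H c \<subseteq> G c \<and> ?K \<le> real (min_degree {1..2 * m} (H c))"
    show "admits_rainbow_perfect_matching {1..2 * m} m H"
    proof (rule rainbow_matching_if_few_dense_spots[where \<delta> = ?\<delta> and K = ?K and D = D and G = G])
      show "card {\<sigma>. \<sigma> permutes {1..2 * m} \<and> dense_spot m D \<sigma> G} < fact (2 * m) / (2 :: real)"
        using G(1) by (simp add: Many_def)
      show "G c \<subseteq> all_edges {1..2 * m}" if "c \<in> {1..m}" for c
        using set_random_graph_family[OF G(2) that] .
    qed (use \<epsilon> H D small' \<open>m > 0\<close> in auto)
  qed
  then have "measure_pmf.prob ?M (- Many \<inter> set_pmf ?M) \<le> measure_pmf.prob ?M ?Good"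
    by (intro measure_pmf.finite_measure_mono) auto
  moreover have "measure_pmf.prob ?M (- Many \<inter> set_pmf ?M) = 1 - measure_pmf.prob ?M Many"
    using measure_pmf.prob_compl[of Many ?M] by (simp add: measure_Int_set_pmf Compl_eq_Diff_UNIV)
  moreover have "measure_pmf.prob ?M Many \<le> 2 * ((1 + exp (- ?\<eta>\<^sup>2 * m * p / 4)) ^ (2 * m) - 1)"
    unfolding Many_def D_def using \<epsilon> by (intro prob_many_dense_spots p) auto
  moreover have "(1 + exp (- ?\<eta>\<^sup>2 * m * p / 4)) ^ (2 * m) \<le> (1 + q) ^ (2 * m)"
  proof (intro power_mono add_left_mono)
    have "0 \<le> \<epsilon>\<^sup>2 * (m * p)" using mp by simp
    then show "exp (- ?\<eta>\<^sup>2 * m * p / 4) \<le> q"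
      unfolding q_def exp_le_cancel_iff by (simp add: field_simps)
  qed simp
  moreover have "1 - 2 * (x - 1) \<le> g" if "a \<le> g" "a = 1 - b" "b \<le> 2 * (y - 1)" "y \<le> x"
    for a b g x y :: real
    using that by (simp add: algebra_simps)
  ultimately show ?thesis by blast
qed

theorem theorem1p2:
  fixes \<epsilon> :: real and p :: "nat \<Rightarrow> real"
  assumes "0 < \<epsilon>" and "\<epsilon> < 1"
    and "\<And>n. even n \<Longrightarrow> 0 \<le> p n \<and> p n \<le> 1"
    and "p \<in> \<omega>[even_at_top](\<lambda>n. ln (real n) / real n)"
  shows "((\<lambda>n. measure_pmf.prob (random_graph_family (n div 2) n (p n))
            {G. \<forall>H. (\<forall>c\<in>{1..n div 2}. H c \<subseteq> G c \<and>
                        real (min_degree {1..n} (H c)) \<ge> (1/2 + \<epsilon>) * real n * p n) \<longrightarrow>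
                    admits_rainbow_perfect_matching {1..n} (n div 2) H})
          \<longlongrightarrow> 1) even_at_top"
  (is "(?P \<longlongrightarrow> 1) _")
proof (rule tendsto_sandwich)
  have ev: "eventually (\<lambda>n. n \<ge> N) even_at_top" for N
    unfolding even_at_top_def by (rule filter_leD[OF inf_le1 eventually_ge_at_top])
  have even: "eventually even even_at_top"
    unfolding even_at_top_def eventually_inf_principal by simp
  \<comment> \<open>The constant is chosen to make \<open>q \<le> 1 / n ^ 3\<close>, small enough for both union bounds.\<close>
  have large: "eventually (\<lambda>n. 864 / \<epsilon>\<^sup>2 * norm (ln (real n) / real n) \<le> norm (p n)) even_at_top"
    using landau_omega.smallD[OF assms(4), of "864 / \<epsilon>\<^sup>2"] assms(1) by simp
  show "eventually (\<lambda>n. 1 - 2 * (exp (1 / real n) - 1) \<le> ?P n) even_at_top"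
    using ev[of 2] even large
  proof eventually_elim
    case (elim n)
    define m where "m = n div 2"
    define q where "q = exp (- \<epsilon>\<^sup>2 * m * p n / 144)"
    have n: "n = 2 * m" and "m > 0" and p: "0 \<le> p n" "p n \<le> 1"
      using elim assms(3)[of n] by (auto simp: m_def)
    have "864 / \<epsilon>\<^sup>2 * (ln n / n) \<le> p n"
      using elim p by simp
    then have "3 * ln n \<le> \<epsilon>\<^sup>2 * m * p n / 144"
      using elim(1) assms(1) by (simp add: n field_simps)
    then have "q \<le> exp (- (3 * ln n))" by (simp add: q_def)
    also have "\<dots> = 1 / real n ^ 3"
      using elim(1) by (simp add: exp_minus exp_of_nat_mult[of 3, simplified] field_simps)
    finally have q: "q \<le> 1 / real n ^ 3" .
    have "(2 * real m)\<^sup>2 * q \<le> real n ^ 2 * (1 / real n ^ 3)"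
      using mult_left_mono[OF q, of "(real n)\<^sup>2"] by (simp only: n of_nat_mult) simp
    also have "\<dots> = 1 / n" using elim(1) by (simp add: power2_eq_square power3_eq_cube)
    also have "\<dots> \<le> 1 / 2" using elim(1) by (simp add: field_simps)
    finally have small: "(2 * real m)\<^sup>2 * q \<le> 1 / 2" .
    have "(1 + q) ^ n \<le> exp q ^ n"
      by (intro power_mono exp_ge_add_one_self) (simp add: q_def)
    also have "\<dots> = exp (n * q)" by (simp add: exp_of_nat_mult)
    also have "n * q \<le> n * (1 / real n ^ 3)" using q by (intro mult_left_mono) auto
    also have "\<dots> \<le> 1 / n" using elim(1) by (simp add: field_simps power3_eq_cube)
    finally have "1 - 2 * (exp (1 / n) - 1) \<le> 1 - 2 * ((1 + q) ^ (2 * m) - 1)" by (simp add: n)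
    also have "\<dots> \<le> ?P n"
      using rainbow_resilience_prob[OF assms(1,2) p \<open>m > 0\<close> small[unfolded q_def]]
      by (simp add: q_def n)
    finally show ?case .
  qed
  show "eventually (\<lambda>n. ?P n \<le> 1) even_at_top" by simp
  have "(\<lambda>n. 1 - 2 * (exp (1 / real n) - 1)) \<longlonglongrightarrow> 1 - 2 * (exp 0 - 1)"
    by (intro tendsto_intros lim_const_over_n)
  then show "((\<lambda>n. 1 - 2 * (exp (1 / real n) - 1)) \<longlongrightarrow> 1) even_at_top"
    unfolding even_at_top_def by (intro tendsto_mono[OF inf_le1]) simp
qed simp

end
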